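(* Let $g\in\mathcal{B}$ be a non-constant function. For each $\gamma>0$, both of the optimal domain spaces $[V_g,A^{-\gamma}]$ and $[V_g,A^{-\gamma}_0]$ are Banach spaces of analytic functions on $\mathbb{D}$. In particular, their dual spaces contain $\{\delta_z: z\in\mathbb{D}\}$.
   Context: $\mathbb{D}$ is the open unit disc in $\mathbb{C}$ and $H(\mathbb{D})$ is the Fréchet space of analytic functions on $\mathbb{D}$ with the topology of uniform convergence on compact sets; $\delta_z$ is the evaluation functional $f\mapsto f(z)$. A Banach space of analytic functions on $\mathbb{D}$ is a vector subspace $X\subseteq H(\mathbb{D})$ which is a Banach space for a norm and such that the natural inclusion $X\to H(\mathbb{D})$ is continuous. For $\gamma>0$, $A^{-\gamma}:=\{f\in H(\mathbb{D}): \|f\|_{-\gamma}:=\sup_{z\in\mathbb{D}}(1-|z|)^\gamma|f(z)|<\infty\}$ and $A^{-\gamma}_0:=\{f\in H(\mathbb{D}): \lim_{|z|\to1^-}(1-|z|)^\gamma|f(z)|=0\}$, both Banach spaces with norm $\|\cdot\|_{-\gamma}$. The Bloch space is $\mathcal{B}:=\{g\in H(\mathbb{D}): \sup_{z\in\mathbb{D}}(1-|z|)|g'(z)|<\infty\}$. The Volterra operator is $(V_gf)(z):=\int_0^zf(\xi)g'(\xi)\,d\xi$ for $f\in H(\mathbb{D})$, $z\in\mathbb{D}$. For $g\in\mathcal{B}$ it is known that $V_g$ maps $A^{-\gamma}$ continuously into $A^{-\gamma}$ and $A^{-\gamma}_0$ continuously into $A^{-\gamma}_0$. The optimal domains are $[V_g,A^{-\gamma}]:=\{f\in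 H(\mathbb{D}): V_gf\in A^{-\gamma}\}$ and $[V_g,A^{-\gamma}_0]:=\{f\in H(\mathbb{D}): V_gf\in A^{-\gamma}_0\}$, each endowed with the norm $f\mapsto\|V_gf\|_{-\gamma}$. *)

theory Defs
  imports "HOL-Complex_Analysis.Complex_Analysis" "HOL-Library.Function_Algebras"
begin

abbreviation unit_disc :: "complex set" (\<open>\<D>\<close>)
  where "\<D> \<equiv> ball 0 1"

text \<open>A function on the disc is represented by its extension by \<open>0\<close> to the whole plane, so that
  equality of representatives is equality on the disc.\<close>

definition hol_disc :: "(complex \<Rightarrow> complex) set"
  where "hol_disc = {f. f holomorphic_on \<D> \<and> (\<forall>z. z \<notin> \<D> \<longrightarrow> f z = 0)}"

text \<open>Uniform convergence on compact sets. The generating sets contain all basic neighbourhoods,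
  and each of them is open because \<open>h - f\<close> attains its maximum modulus on \<open>K\<close>.\<close>

definition hol_disc_topology :: "(complex \<Rightarrow> complex) topology"
  where "hol_disc_topology = topology_generated_by
    {{h \<in> hol_disc. \<forall>z\<in>K. cmod (h z - f z) < e} |f K e.
       f \<in> hol_disc \<and> compact K \<and> K \<subseteq> \<D> \<and> e > 0}"

definition fun_scale :: "complex \<Rightarrow> (complex \<Rightarrow> complex) \<Rightarrow> (complex \<Rightarrow> complex)"
  where "fun_scale c f = (\<lambda>z. c * f z)"

lemma vector_space_fun_scale: "vector_space fun_scale"
  by unfold_locales (auto simp: fun_scale_def fun_eq_iff algebra_simps)

definition is_norm_on :: "(complex \<Rightarrow> complex) set \<Rightarrow> ((complex \<Rightarrow> complex) \<Rightarrow> real) \<Rightarrow> bool"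
  where "is_norm_on X N \<longleftrightarrow>
    (\<forall>f\<in>X. 0 \<le> N f \<and> (N f = 0 \<longleftrightarrow> f = 0)) \<and>
    (\<forall>c. \<forall>f\<in>X. N (fun_scale c f) = cmod c * N f) \<and>
    (\<forall>f\<in>X. \<forall>h\<in>X. N (f + h) \<le> N f + N h)"

text \<open>The value \<open>0\<close> off \<open>X\<close> is needed because the locale \<open>Metric_space\<close> asks for nonnegativity and
  symmetry on the whole type, while \<open>N\<close> is only controlled on \<open>X\<close>.\<close>

definition norm_dist ::
  "(complex \<Rightarrow> complex) set \<Rightarrow> ((complex \<Rightarrow> complex) \<Rightarrow> real)
    \<Rightarrow> (complex \<Rightarrow> complex) \<Rightarrow> (complex \<Rightarrow> complex) \<Rightarrow> real"
  where "norm_dist X N f h = (if f \<in> X \<and> h \<in> X then N (f - h) else 0)"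

lemma Metric_space_norm_dist:
  assumes sub: "module.subspace fun_scale X" and N: "is_norm_on X N"
  shows "Metric_space X (norm_dist X N)"
proof -
  interpret vector_space fun_scale by (rule vector_space_fun_scale)
  have diff: "f - h \<in> X" if "f \<in> X" "h \<in> X" for f h
    using subspace_diff[OF sub that] .
  have comm: "N (f - h) = N (h - f)" if "f \<in> X" "h \<in> X" for f h
  proof -
    have "N (fun_scale (-1) (h - f)) = cmod (-1) * N (h - f)"
      using N diff[OF that(2,1)] unfolding is_norm_on_def by blast
    moreover have "fun_scale (-1) (h - f) = f - h"
      by (auto simp: fun_scale_def)
    ultimately show ?thesis by simp
  qed
  have tri: "N (f - k) \<le> N (f - h) + N (h - k)" if "f \<in> X" "h \<in> X" "k \<in> X" for f h k
  proof -
    have "N ((f - h) + (h - k)) \<le> N (f - h) + N (h - k)"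
      using N diff[OF that(1,2)] diff[OF that(2,3)] unfolding is_norm_on_def by blast
    moreover have "(f - h) + (h - k) = f - k"
      by (simp add: fun_eq_iff)
    ultimately show ?thesis by simp
  qed
  show ?thesis
  proof
    fix f h :: "complex \<Rightarrow> complex"
    show "0 \<le> norm_dist X N f h"
      using N diff unfolding norm_dist_def is_norm_on_def by simp
    show "norm_dist X N f h = norm_dist X N h f"
      using comm[of f h] unfolding norm_dist_def by presburger
  next
    fix f h assume "f \<in> X" "h \<in> X"
    then show "norm_dist X N f h = 0 \<longleftrightarrow> f = h"
      using N diff[of f h] unfolding norm_dist_def is_norm_on_def by simp
  next
    fix f h k assume "f \<in> X" "h \<in> X" "k \<in> X"
    then show "norm_dist X N f k \<le> norm_dist X N f h + norm_dist X N h k"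
      using tri[of f h k] unfolding norm_dist_def by simp
  qed
qed

definition banach_space_of_analytic_functions ::
  "(complex \<Rightarrow> complex) set \<Rightarrow> ((complex \<Rightarrow> complex) \<Rightarrow> real) \<Rightarrow> bool"
  where "banach_space_of_analytic_functions X N \<longleftrightarrow>
    X \<subseteq> hol_disc \<and> module.subspace fun_scale X \<and> is_norm_on X N \<and>
    Metric_space.mcomplete X (norm_dist X N) \<and>
    continuous_map (Metric_space.mtopology X (norm_dist X N)) hol_disc_topology (\<lambda>f. f)"

text \<open>Functionals are taken extensional (\<open>undefined\<close> off \<open>X\<close>).\<close>

definition dual_space ::
  "(complex \<Rightarrow> complex) set \<Rightarrow> ((complex \<Rightarrow> complex) \<Rightarrow> real)
    \<Rightarrow> ((complex \<Rightarrow> complex) \<Rightarrow> complex) set"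
  where "dual_space X N = {\<phi> \<in> extensional X.
    (\<forall>f\<in>X. \<forall>h\<in>X. \<phi> (f + h) = \<phi> f + \<phi> h) \<and>
    (\<forall>c. \<forall>f\<in>X. \<phi> (fun_scale c f) = c * \<phi> f) \<and>
    continuous_map (Metric_space.mtopology X (norm_dist X N)) euclidean \<phi>}"

definition point_eval :: "(complex \<Rightarrow> complex) set \<Rightarrow> complex \<Rightarrow> (complex \<Rightarrow> complex) \<Rightarrow> complex"
  where "point_eval X z = restrict (\<lambda>f. f z) X"

definition growth_norm :: "real \<Rightarrow> (complex \<Rightarrow> complex) \<Rightarrow> real"
  where "growth_norm \<gamma> f = (SUP z\<in>\<D>. (1 - cmod z) powr \<gamma> * cmod (f z))"

definition growth_space :: "real \<Rightarrow> (complex \<Rightarrow> complex) set"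
  where "growth_space \<gamma> =
    {f \<in> hol_disc. bdd_above ((\<lambda>z. (1 - cmod z) powr \<gamma> * cmod (f z)) ` \<D>)}"

definition growth_space0 :: "real \<Rightarrow> (complex \<Rightarrow> complex) set"
  where "growth_space0 \<gamma> =
    {f \<in> hol_disc. ((\<lambda>z. (1 - cmod z) powr \<gamma> * cmod (f z)) \<longlongrightarrow> 0) (filtercomap cmod (at_left 1))}"

definition bloch_space :: "(complex \<Rightarrow> complex) set"
  where "bloch_space = {g \<in> hol_disc. bdd_above ((\<lambda>z. (1 - cmod z) * cmod (deriv g z)) ` \<D>)}"

definition volterra :: "(complex \<Rightarrow> complex) \<Rightarrow> (complex \<Rightarrow> complex) \<Rightarrow> (complex \<Rightarrow> complex)"
  where "volterra g f =
    (\<lambda>z. if z \<in> \<D> then contour_integral (linepath 0 z) (\<lambda>\<xi>. f \<xi> * deriv g \<xi>) else 0)"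

definition optimal_domain ::
  "(complex \<Rightarrow> complex) \<Rightarrow> (complex \<Rightarrow> complex) set \<Rightarrow> (complex \<Rightarrow> complex) set"
  where "optimal_domain g Y = {f \<in> hol_disc. volterra g f \<in> Y}"

definition optimal_norm :: "(complex \<Rightarrow> complex) \<Rightarrow> real \<Rightarrow> (complex \<Rightarrow> complex) \<Rightarrow> real"
  where "optimal_norm g \<gamma> f = growth_norm \<gamma> (volterra g f)"

end

theory Submission
  imports Defs
begin

text \<open>Since \<open>volterra g f\<close> is a primitive of \<open>f * deriv g\<close>, Cauchy's inequality bounds
  \<open>f * deriv g\<close> on every smaller disc by the optimal norm of \<open>f\<close>. Dividing by \<open>deriv g\<close> on a circle
  that avoids its zeros and applying the maximum modulus principle inside that circle bounds \<open>f\<close>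
  itself. So the optimal norm dominates uniform convergence on compact sets; a Cauchy sequence
  converges locally uniformly, and its images under the Volterra operator converge in the growth
  norm because the Cauchy estimate passes to the pointwise limit.\<close>

section \<open>Functions on the disc\<close>

lemma hol_discD:
  assumes "f \<in> hol_disc"
  shows "f holomorphic_on \<D>" "z \<notin> \<D> \<Longrightarrow> f z = 0"
  using assms by (auto simp: hol_disc_def)

lemma subspace_fun_scale_iff:
  "module.subspace fun_scale X \<longleftrightarrow>
    0 \<in> X \<and> (\<forall>f\<in>X. \<forall>h\<in>X. f + h \<in> X) \<and> (\<forall>c. \<forall>f\<in>X. fun_scale c f \<in> X)"
proof -
  interpret vector_space fun_scale by (rule vector_space_fun_scale)
  show ?thesis by (simp add: subspace_def)
qed

lemma subspace_fun_scale_diff: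
  assumes "module.subspace fun_scale X" "f \<in> X" "h \<in> X"
  shows "f - h \<in> X"
proof -
  interpret vector_space fun_scale by (rule vector_space_fun_scale)
  show ?thesis using assms by (rule subspace_diff)
qed

lemma subspace_hol_disc: "module.subspace fun_scale hol_disc"
  by (auto simp: subspace_fun_scale_iff hol_disc_def fun_scale_def zero_fun_def plus_fun_def
      intro!: holomorphic_intros)

text \<open>The modulus attains its maximum on a nonempty compact set, and the maximum is below
  \<open>1\<close>. This lets every later estimate on compact sets be made on closed discs about
  \<open>0\<close>.\<close>

lemma compact_subset_unit_disc:
  fixes K :: "complex set"
  assumes "compact K" "K \<subseteq> \<D>"
  obtains r where "r < 1" "K \<subseteq> cball 0 r"
proof (cases "K = {}")
  case True
  then show thesis using that[of 0] by simp
next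
  case False
  obtain w where w: "w \<in> K" "\<forall>z\<in>K. cmod z \<le> cmod w"
    using continuous_attains_sup[OF assms(1) False, of cmod] continuous_on_norm_id by blast
  have "cmod w < 1" using w(1) assms(2) by auto
  moreover have "K \<subseteq> cball 0 (cmod w)" using w(2) by auto
  ultimately show thesis by (rule that)
qed

text \<open>Weierstrass' theorem as a completeness statement for the analytic functions on the disc.
  Each point has a small closed disc inside some \<open>cball 0 r\<close> with \<open>r < 1\<close>,
  so uniform convergence on centred discs is already local uniform convergence. The limit is set to
  \<open>0\<close> off the disc, as \<open>hol_disc\<close> demands.\<close>

lemma hol_disc_uniform_Cauchy_limit:
  assumes \<sigma>: "\<And>n. \<sigma> n \<in> hol_disc"
    and Cauchy: "\<And>r. r < 1 \<Longrightarrow> uniformly_Cauchy_on (cball 0 r) \<sigma>"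
  obtains f where "f \<in> hol_disc" "\<And>r. r < 1 \<Longrightarrow> uniform_limit (cball 0 r) \<sigma> f sequentially"
proof -
  define f where "f = (\<lambda>z. if z \<in> \<D> then lim (\<lambda>n. \<sigma> n z) else 0)"
  have lim: "uniform_limit (cball 0 r) \<sigma> f sequentially" if "r < 1" for r
  proof -
    have "uniform_limit (cball 0 r) \<sigma> (\<lambda>z. lim (\<lambda>n. \<sigma> n z)) sequentially"
      using Cauchy[OF that] Cauchy_uniformly_convergent uniformly_convergent_uniform_limit_iff
      by blast
    then show ?thesis
      by (rule uniform_limit_cong'[THEN iffD1, rotated 2]) (use that in \<open>auto simp: f_def\<close>)
  qed
  have "f holomorphic_on \<D>"
  proof (rule holomorphic_uniform_sequence)
    show "\<sigma> n holomorphic_on \<D>" for n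
      using \<sigma> by (rule hol_discD)
    fix z :: complex assume "z \<in> \<D>"
    then obtain d where d: "d > 0" "cball z d \<subseteq> \<D>"
      using open_contains_cball open_ball by metis
    then obtain r where "r < 1" "cball z d \<subseteq> cball 0 r"
      using compact_subset_unit_disc[of "cball z d"] by auto
    then show "\<exists>d. 0 < d \<and> cball z d \<subseteq> \<D> \<and> uniform_limit (cball z d) \<sigma> f sequentially"
      using d lim uniform_limit_on_subset by blast
  qed simp
  then have "f \<in> hol_disc"
    by (simp add: hol_disc_def f_def)
  then show thesis using lim that by blast
qed

section \<open>Norms that dominate the supremum on compact sets\<close>

text \<open>Preimages of the generating sets decide continuity. A small norm of \<open>h - k\<close>
  forces \<open>h\<close> and \<open>k\<close> to be close on the whole compact set, so a norm ball
  around \<open>h\<close> stays in the generating set that contains \<open>h\<close>.\<close>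

lemma continuous_map_into_hol_disc_topology:
  assumes X: "X \<subseteq> hol_disc" and sub: "module.subspace fun_scale X" and N: "is_norm_on X N"
    and bound: "\<And>r. r < 1 \<Longrightarrow> \<exists>C. \<forall>f\<in>X. \<forall>z\<in>cball 0 r. cmod (f z) \<le> C * N f"
  shows "continuous_map (Metric_space.mtopology X (norm_dist X N)) hol_disc_topology (\<lambda>f. f)"
proof -
  interpret Metric_space X "norm_dist X N"
    using sub N by (rule Metric_space_norm_dist)
  show ?thesis
    unfolding hol_disc_topology_def
  proof (rule continuous_on_generated_topo)
    fix U assume "U \<in> {{h \<in> hol_disc. \<forall>z\<in>K. cmod (h z - f z) < e} |f K e.
       f \<in> hol_disc \<and> compact K \<and> K \<subseteq> \<D> \<and> e > 0}"
    then obtain f K e where U: "U = {h \<in> hol_disc. \<forall>z\<in>K. cmod (h z - f z) < e}"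
      and f: "f \<in> hol_disc" and K: "compact K" "K \<subseteq> \<D>" and e: "e > 0"
      by blast
    obtain r where r: "r < 1" "K \<subseteq> cball 0 r"
      using compact_subset_unit_disc[OF K] .
    obtain C where C: "\<And>h z. h \<in> X \<Longrightarrow> z \<in> K \<Longrightarrow> cmod (h z) \<le> C * N h"
      using bound[OF r(1)] r(2) by blast
    have "\<exists>s>0. mball h s \<subseteq> U" if h: "h \<in> X" "h \<in> U" for h
    proof -
      \<comment> \<open>The strict inequality holds at each point of \<open>K\<close> separately;
        since the maximum over \<open>K\<close> is attained, a uniform gap \<open>e - b\<close> is
        left for moving \<open>h\<close>.\<close>
      have "\<exists>b<e. \<forall>z\<in>K. cmod (h z - f z) \<le> b"
      proof (cases "K = {}")
        case True
        then show ?thesis using e by auto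
      next
        case False
        have "continuous_on K (\<lambda>z. cmod (h z - f z))"
          using hol_discD(1)[OF f] hol_discD(1)[of h] h U K(2)
          by (intro continuous_intros holomorphic_on_imp_continuous_on)
             (auto intro: holomorphic_on_subset)
        then obtain w where "w \<in> K" "\<forall>z\<in>K. cmod (h z - f z) \<le> cmod (h w - f w)"
          using continuous_attains_sup[OF K(1) False] by blast
        then show ?thesis using h U by auto
      qed
      then obtain b where b: "b < e" "\<And>z. z \<in> K \<Longrightarrow> cmod (h z - f z) \<le> b"
        by blast
      \<comment> \<open>The constant \<open>C\<close> comes with no sign, so
        \<open>\<bar>C\<bar> + 1\<close> serves as a positive upper bound for it and gives a strict
        inequality below.\<close>
      define s where "s = (e - b) / (\<bar>C\<bar> + 1)"
      have s: "s > 0" using b(1) by (simp add: s_def)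
      have "k \<in> U" if k: "k \<in> mball h s" for k
      proof -
        have kX: "k \<in> X" and dist: "N (h - k) < s"
          using k h(1) by (auto simp: norm_dist_def)
        have hk: "h - k \<in> X" using subspace_fun_scale_diff[OF sub h(1) kX] .
        then have N0: "N (h - k) \<ge> 0" using N by (simp add: is_norm_on_def)
        have "cmod (k z - f z) < e" if z: "z \<in> K" for z
        proof -
          have "cmod (h z - k z) \<le> C * N (h - k)"
            using C[OF hk z] by simp
          also have "\<dots> \<le> (\<bar>C\<bar> + 1) * N (h - k)"
            using N0 by (intro mult_right_mono) auto
          also have "\<dots> < (\<bar>C\<bar> + 1) * s"
            using dist by (intro mult_strict_left_mono) auto
          also have "\<dots> = e - b" by (simp add: s_def)
          finally have "cmod (h z - k z) < e - b" .
          moreover have "cmod (k z - f z) \<le> cmod (h z - f z) + cmod (h z - k z)"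
            using norm_triangle_ineq4[of "h z - f z" "h z - k z"] by simp
          ultimately show ?thesis using b(2)[OF z] by linarith
        qed
        then show ?thesis using kX X U by auto
      qed
      then show ?thesis using s by blast
    qed
    then show "openin mtopology ((\<lambda>f. f) -` U \<inter> topspace mtopology)"
      by (force simp: openin_mtopology)
  next
    \<comment> \<open>With \<open>K = {}\<close> the defining condition is vacuous, so all of
      \<open>hol_disc\<close> is one of the generating sets and these sets cover
      \<open>X\<close>.\<close>
    have "hol_disc \<in> {{h \<in> hol_disc. \<forall>z\<in>K. cmod (h z - f z) < e} |f K e.
       f \<in> hol_disc \<and> compact K \<and> K \<subseteq> \<D> \<and> e > 0}"
      using subspace_hol_disc unfolding subspace_fun_scale_iff
      by (intro CollectI exI[of _ 0] exI[of _ "{}"] exI[of _ 1]) simp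
    then show "(\<lambda>f. f) ` topspace mtopology \<subseteq> \<Union> {{h \<in> hol_disc. \<forall>z\<in>K. cmod (h z - f z) < e} |f K e.
       f \<in> hol_disc \<and> compact K \<and> K \<subseteq> \<D> \<and> e > 0}"
      using X by auto
  qed
qed

text \<open>A single point is compact, so the generating set with \<open>K = {z}\<close> around
  \<open>f\<close> consists of functions whose value at \<open>z\<close> is within \<open>e\<close>
  of \<open>f z\<close>.\<close>

lemma continuous_map_eval_hol_disc_topology:
  assumes z: "z \<in> \<D>"
  shows "continuous_map hol_disc_topology euclidean (\<lambda>f. f z)"
proof -
  have top: "topspace hol_disc_topology \<subseteq> hol_disc"
    by (auto simp: hol_disc_topology_def)
  have "openin hol_disc_topology {f \<in> topspace hol_disc_topology. f z \<in> U}" if "open U" for U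
  proof (subst openin_subopen, safe)
    fix f assume f: "f \<in> topspace hol_disc_topology" "f z \<in> U"
    then have fh: "f \<in> hol_disc" using top by auto
    obtain e where e: "e > 0" "ball (f z) e \<subseteq> U"
      using \<open>open U\<close> f(2) open_contains_ball by blast
    define T where "T = {h \<in> hol_disc. \<forall>w\<in>{z}. cmod (h w - f w) < e}"
    have "openin hol_disc_topology T"
      unfolding hol_disc_topology_def T_def
      by (rule topology_generated_by_Basis) (use fh e z in
          \<open>intro CollectI exI[of _ f] exI[of _ "{z}"] exI[of _ e], simp\<close>)
    moreover have "f \<in> T" using fh e by (simp add: T_def)
    moreover have "T \<subseteq> {f \<in> topspace hol_disc_topology. f z \<in> U}"
      using openin_subset[OF calculation(1)] e(2)
      by (auto simp: T_def dist_norm norm_minus_commute)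
    ultimately show "\<exists>T. openin hol_disc_topology T \<and> f \<in> T \<and>
        T \<subseteq> {f \<in> topspace hol_disc_topology. f z \<in> U}"
      by blast
  qed
  then show ?thesis by (simp add: continuous_map_def)
qed

text \<open>Evaluation on \<open>X\<close> is the continuous inclusion into
  \<open>hol_disc_topology\<close> followed by the continuous evaluation there; linearity is
  pointwise.\<close>

lemma point_eval_in_dual_space:
  assumes banach: "banach_space_of_analytic_functions X N" and z: "z \<in> \<D>"
  shows "point_eval X z \<in> dual_space X N"
proof -
  have sub: "module.subspace fun_scale X" and N: "is_norm_on X N"
    and cont: "continuous_map (Metric_space.mtopology X (norm_dist X N)) hol_disc_topology (\<lambda>f. f)"
    using banach by (auto simp: banach_space_of_analytic_functions_def)
  interpret Metric_space X "norm_dist X N"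
    using sub N by (rule Metric_space_norm_dist)
  have "continuous_map mtopology euclidean (\<lambda>f. f z)"
    using continuous_map_compose[OF cont continuous_map_eval_hol_disc_topology[OF z]]
    by (simp add: o_def)
  then have "continuous_map mtopology euclidean (point_eval X z)"
    by (rule continuous_map_eq) (simp add: point_eval_def)
  then show ?thesis
    using sub by (auto simp: dual_space_def point_eval_def subspace_fun_scale_iff fun_scale_def)
qed

section \<open>Growth spaces\<close>

lemma growth_norm_upper:
  assumes "f \<in> growth_space \<gamma>" "z \<in> \<D>"
  shows "(1 - cmod z) powr \<gamma> * cmod (f z) \<le> growth_norm \<gamma> f"
  using assms unfolding growth_norm_def growth_space_def by (auto intro: cSUP_upper)

lemma growth_norm_least:
  assumes "\<And>z. z \<in> \<D> \<Longrightarrow> (1 - cmod z) powr \<gamma> * cmod (f z) \<le> B"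
  shows "growth_norm \<gamma> f \<le> B"
  unfolding growth_norm_def using assms by (intro cSUP_least) auto

lemma growth_norm_nonneg:
  assumes "f \<in> growth_space \<gamma>"
  shows "0 \<le> growth_norm \<gamma> f"
proof -
  have "0 \<le> (1 - cmod 0) powr \<gamma> * cmod (f 0)" by simp
  also have "\<dots> \<le> growth_norm \<gamma> f" using assms by (intro growth_norm_upper) auto
  finally show ?thesis .
qed

lemma growth_spaceI:
  assumes "f \<in> hol_disc" "\<And>z. z \<in> \<D> \<Longrightarrow> (1 - cmod z) powr \<gamma> * cmod (f z) \<le> B"
  shows "f \<in> growth_space \<gamma>"
  using assms unfolding growth_space_def by (auto intro!: bdd_aboveI2)

lemma weighted_add_le:
  "(1 - cmod z) powr \<gamma> * cmod (f z + h z) \<le>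
    (1 - cmod z) powr \<gamma> * cmod (f z) + (1 - cmod z) powr \<gamma> * cmod (h z)"
  by (metis norm_triangle_ineq distrib_left mult_left_mono powr_ge_zero)

lemma growth_norm_add:
  assumes "f \<in> growth_space \<gamma>" "h \<in> growth_space \<gamma>"
  shows "growth_norm \<gamma> (f + h) \<le> growth_norm \<gamma> f + growth_norm \<gamma> h"
proof (rule growth_norm_least)
  fix z :: complex assume z: "z \<in> \<D>"
  show "(1 - cmod z) powr \<gamma> * cmod ((f + h) z) \<le> growth_norm \<gamma> f + growth_norm \<gamma> h"
    using weighted_add_le[of z \<gamma> f h] growth_norm_upper[OF assms(1) z]
      growth_norm_upper[OF assms(2) z] by simp
qed

lemma subspace_growth_space: "module.subspace fun_scale (growth_space \<gamma>)"
  unfolding subspace_fun_scale_iff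
proof (intro conjI ballI allI)
  have sub: "0 \<in> hol_disc" "\<And>f h. f \<in> hol_disc \<Longrightarrow> h \<in> hol_disc \<Longrightarrow> f + h \<in> hol_disc"
    "\<And>c f. f \<in> hol_disc \<Longrightarrow> fun_scale c f \<in> hol_disc"
    using subspace_hol_disc by (auto simp: subspace_fun_scale_iff)
  show "0 \<in> growth_space \<gamma>"
    by (rule growth_spaceI[where B = 0]) (use sub in auto)
  fix f assume f: "f \<in> growth_space \<gamma>"
  then have fh: "f \<in> hol_disc" by (simp add: growth_space_def)
  show "fun_scale c f \<in> growth_space \<gamma>" for c
  proof (rule growth_spaceI)
    show "fun_scale c f \<in> hol_disc" using sub fh by blast
    fix z :: complex assume "z \<in> \<D>"
    then show "(1 - cmod z) powr \<gamma> * cmod (fun_scale c f z) \<le> cmod c * growth_norm \<gamma> f"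
      using mult_left_mono[OF growth_norm_upper[OF f], of z "cmod c"]
      by (simp add: fun_scale_def norm_mult mult_ac)
  qed
  fix h assume h: "h \<in> growth_space \<gamma>"
  then have hh: "h \<in> hol_disc" by (simp add: growth_space_def)
  show "f + h \<in> growth_space \<gamma>"
  proof (rule growth_spaceI)
    show "f + h \<in> hol_disc" using sub fh hh by blast
    fix z :: complex assume z: "z \<in> \<D>"
    show "(1 - cmod z) powr \<gamma> * cmod ((f + h) z) \<le> growth_norm \<gamma> f + growth_norm \<gamma> h"
      using weighted_add_le[of z \<gamma> f h] growth_norm_upper[OF f z]
        growth_norm_upper[OF h z] by simp
  qed
qed

text \<open>Only one inequality needs the supremum. The reverse one is the same inequality applied
  to \<open>fun_scale c f\<close> and the scalar \<open>inverse c\<close>; for \<open>c = 0\<close>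
  nonnegativity of the norm replaces it.\<close>

lemma growth_norm_scale:
  assumes f: "f \<in> growth_space \<gamma>"
  shows "growth_norm \<gamma> (fun_scale c f) = cmod c * growth_norm \<gamma> f"
proof -
  have le: "growth_norm \<gamma> (fun_scale c f) \<le> cmod c * growth_norm \<gamma> f"
    if "f \<in> growth_space \<gamma>" for c f
  proof (rule growth_norm_least)
    fix z :: complex assume "z \<in> \<D>"
    then show "(1 - cmod z) powr \<gamma> * cmod (fun_scale c f z) \<le> cmod c * growth_norm \<gamma> f"
      using mult_left_mono[OF growth_norm_upper[OF that], of z "cmod c"]
      by (simp add: fun_scale_def norm_mult mult_ac)
  qed
  have cf: "fun_scale c f \<in> growth_space \<gamma>"
    using subspace_growth_space f by (simp add: subspace_fun_scale_iff)
  show ?thesis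
  proof (cases "c = 0")
    case True
    then show ?thesis using le[OF f, of c] growth_norm_nonneg[OF cf] by simp
  next
    case False
    then have "fun_scale (inverse c) (fun_scale c f) = f"
      by (simp add: fun_scale_def fun_eq_iff)
    then have "growth_norm \<gamma> f \<le> inverse (cmod c) * growth_norm \<gamma> (fun_scale c f)"
      using le[OF cf, of "inverse c"] by (simp add: norm_inverse)
    then have "cmod c * growth_norm \<gamma> f \<le> growth_norm \<gamma> (fun_scale c f)"
      using False by (simp add: field_simps)
    then show ?thesis using le[OF f, of c] by simp
  qed
qed

text \<open>The filter of the radial limit is generated by the annuli \<open>b < cmod z < 1\<close>,
  which gives an epsilon form suited to uniform approximation.\<close>

lemma growth_space0_iff:
  "f \<in> growth_space0 \<gamma> \<longleftrightarrow> f \<in> hol_disc \<and>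
    (\<forall>e>0. \<exists>b<1. \<forall>z\<in>\<D>. b < cmod z \<longrightarrow> (1 - cmod z) powr \<gamma> * cmod (f z) < e)"
proof -
  have ev: "eventually P (filtercomap cmod (at_left 1)) \<longleftrightarrow> (\<exists>b<1. \<forall>z\<in>\<D>. b < cmod z \<longrightarrow> P z)" for P
  proof
    assume "eventually P (filtercomap cmod (at_left 1))"
    then obtain Q b where "b < 1" "\<And>y. b < y \<Longrightarrow> y < 1 \<Longrightarrow> Q y" "\<And>z. Q (cmod z) \<Longrightarrow> P z"
      unfolding eventually_filtercomap eventually_at_left_field by blast
    then show "\<exists>b<1. \<forall>z\<in>\<D>. b < cmod z \<longrightarrow> P z"
      by (intro exI[of _ b]) auto
  next
    assume "\<exists>b<1. \<forall>z\<in>\<D>. b < cmod z \<longrightarrow> P z"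
    then obtain b where "b < 1" "\<forall>z\<in>\<D>. b < cmod z \<longrightarrow> P z" by blast
    then show "eventually P (filtercomap cmod (at_left 1))"
      unfolding eventually_filtercomap eventually_at_left_field
      by (intro exI[of _ "\<lambda>y. b < y \<and> y < 1"]) auto
  qed
  show ?thesis
    unfolding growth_space0_def tendsto_iff ev by simp
qed

text \<open>Near the boundary the weighted modulus is below \<open>1\<close>; on the remaining
  closed disc it is continuous, hence bounded.\<close>

lemma growth_space0_subset: "growth_space0 \<gamma> \<subseteq> growth_space \<gamma>"
proof
  fix f assume "f \<in> growth_space0 \<gamma>"
  then obtain b where f: "f \<in> hol_disc" and b: "b < 1"
    "\<And>z. z \<in> \<D> \<Longrightarrow> b < cmod z \<Longrightarrow> (1 - cmod z) powr \<gamma> * cmod (f z) < 1"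
    unfolding growth_space0_iff by (metis zero_less_one)
  have "continuous_on (cball 0 b) f"
    using hol_discD(1)[OF f] b(1)
    by (intro holomorphic_on_imp_continuous_on) (auto intro: holomorphic_on_subset)
  then have "continuous_on (cball 0 b) (\<lambda>z. (1 - cmod z) powr \<gamma> * cmod (f z))"
    using b(1) by (intro continuous_intros) auto
  then have "bdd_above ((\<lambda>z. (1 - cmod z) powr \<gamma> * cmod (f z)) ` cball 0 b)"
    by (intro bounded_imp_bdd_above compact_imp_bounded compact_continuous_image) auto
  then obtain M where M: "\<And>z. z \<in> cball 0 b \<Longrightarrow> (1 - cmod z) powr \<gamma> * cmod (f z) \<le> M"
    unfolding bdd_above_def by (metis imageI)
  show "f \<in> growth_space \<gamma>"
  proof (rule growth_spaceI[OF f])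
    fix z :: complex assume "z \<in> \<D>"
    then show "(1 - cmod z) powr \<gamma> * cmod (f z) \<le> max M 1"
      using M[of z] b(2)[of z] by (cases "b < cmod z") auto
  qed
qed

lemma subspace_growth_space0: "module.subspace fun_scale (growth_space0 \<gamma>)"
proof -
  let ?F = "filtercomap cmod (at_left 1)"
  have sub: "0 \<in> hol_disc" "\<And>f h. f \<in> hol_disc \<Longrightarrow> h \<in> hol_disc \<Longrightarrow> f + h \<in> hol_disc"
    "\<And>c f. f \<in> hol_disc \<Longrightarrow> fun_scale c f \<in> hol_disc"
    using subspace_hol_disc by (auto simp: subspace_fun_scale_iff)
  have "((\<lambda>z. (1 - cmod z) powr \<gamma> * cmod ((f + h) z)) \<longlongrightarrow> 0) ?F"
    if "((\<lambda>z. (1 - cmod z) powr \<gamma> * cmod (f z)) \<longlongrightarrow> 0) ?F"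
      "((\<lambda>z. (1 - cmod z) powr \<gamma> * cmod (h z)) \<longlongrightarrow> 0) ?F" for f h
  proof (rule tendsto_sandwich[OF _ _ tendsto_const tendsto_add_zero[OF that]])
    show "\<forall>\<^sub>F z in ?F. (1 - cmod z) powr \<gamma> * cmod ((f + h) z) \<le>
        (1 - cmod z) powr \<gamma> * cmod (f z) + (1 - cmod z) powr \<gamma> * cmod (h z)"
      using weighted_add_le[of _ \<gamma> f h] by (intro always_eventually) simp
  qed simp
  moreover have "((\<lambda>z. (1 - cmod z) powr \<gamma> * cmod (fun_scale c f z)) \<longlongrightarrow> 0) ?F"
    if "((\<lambda>z. (1 - cmod z) powr \<gamma> * cmod (f z)) \<longlongrightarrow> 0) ?F" for c f
    using tendsto_mult_left[OF that, of "cmod c"] by (simp add: fun_scale_def norm_mult mult_ac)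
  ultimately show ?thesis
    using sub by (auto simp: growth_space0_def subspace_fun_scale_iff)
qed

text \<open>The approximation is stated pointwise and not through \<open>growth_norm\<close>: before
  \<open>F\<close> is known to lie in the space, the set of weighted values may be unbounded and its
  real supremum would say nothing.\<close>

lemma growth_space_closed:
  assumes F: "F \<in> hol_disc"
    and approx: "\<And>e. e > 0 \<Longrightarrow>
      \<exists>h\<in>growth_space \<gamma>. \<forall>z\<in>\<D>. (1 - cmod z) powr \<gamma> * cmod (F z - h z) \<le> e"
  shows "F \<in> growth_space \<gamma>"
proof -
  obtain h where h: "h \<in> growth_space \<gamma>"
    and d: "\<And>z. z \<in> \<D> \<Longrightarrow> (1 - cmod z) powr \<gamma> * cmod (F z - h z) \<le> 1"
    using approx[of 1] by auto
  show ?thesis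
  proof (rule growth_spaceI[OF F])
    fix z :: complex assume z: "z \<in> \<D>"
    show "(1 - cmod z) powr \<gamma> * cmod (F z) \<le> 1 + growth_norm \<gamma> h"
      using weighted_add_le[of z \<gamma> "\<lambda>z. F z - h z" h] d[OF z] growth_norm_upper[OF h z] by simp
  qed
qed

text \<open>A uniform limit of weighted moduli that vanish at the boundary vanishes there too: half
  of \<open>e\<close> pays for the approximation, half for the decay of the approximant.\<close>

lemma growth_space0_closed:
  assumes F: "F \<in> hol_disc"
    and approx: "\<And>e. e > 0 \<Longrightarrow>
      \<exists>h\<in>growth_space0 \<gamma>. \<forall>z\<in>\<D>. (1 - cmod z) powr \<gamma> * cmod (F z - h z) \<le> e"
  shows "F \<in> growth_space0 \<gamma>"
  unfolding growth_space0_iff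
proof (intro conjI allI impI F)
  fix e :: real assume e: "e > 0"
  obtain h where h: "h \<in> growth_space0 \<gamma>"
    and d: "\<And>z. z \<in> \<D> \<Longrightarrow> (1 - cmod z) powr \<gamma> * cmod (F z - h z) \<le> e / 2"
    using approx[of "e / 2"] e by auto
  obtain b where b: "b < 1"
    "\<And>z. z \<in> \<D> \<Longrightarrow> b < cmod z \<Longrightarrow> (1 - cmod z) powr \<gamma> * cmod (h z) < e / 2"
    using h e unfolding growth_space0_iff by (meson half_gt_zero)
  have "(1 - cmod z) powr \<gamma> * cmod (F z) < e" if z: "z \<in> \<D>" "b < cmod z" for z
    using weighted_add_le[of z \<gamma> "\<lambda>z. F z - h z" h] d[OF z(1)] b(2)[OF z] by simp
  then show "\<exists>b<1. \<forall>z\<in>\<D>. b < cmod z \<longrightarrow> (1 - cmod z) powr \<gamma> * cmod (F z) < e"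
    using b(1) by blast
qed

text \<open>Discs of one fixed radius around the points of \<open>cball 0 r\<close> stay away from
  the unit circle. There the weight is bounded below, so the growth norm bounds \<open>F\<close>
  itself, and Cauchy's inequality passes this bound to the derivative.\<close>

lemma growth_space_deriv_bound:
  assumes "r < 1"
  obtains C where "C \<ge> 0"
    "\<And>F z. F \<in> growth_space \<gamma> \<Longrightarrow> z \<in> cball 0 r \<Longrightarrow> cmod (deriv F z) \<le> C * growth_norm \<gamma> F"
proof -
  \<comment> \<open>Half of the gap to the unit circle: the points of \<open>cball z s\<close> have
    modulus at most \<open>r + s = 1 - s\<close>.\<close>
  define s where "s = (1 - r) / 2"
  have s: "s > 0" "r + s < 1" using assms by (auto simp: s_def field_simps)
  \<comment> \<open>On these discs \<open>s \<le> 1 - cmod x \<le> 1\<close>. The weight is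
    therefore at least \<open>s powr \<gamma>\<close> if \<open>\<gamma> \<ge> 0\<close> and at
    least \<open>1\<close> otherwise; the minimum covers both signs.\<close>
  define c where "c = min (s powr \<gamma>) 1"
  have c: "c > 0" using s by (simp add: c_def)
  have bound: "cmod (deriv F z) \<le> inverse (c * s) * growth_norm \<gamma> F"
    if F: "F \<in> growth_space \<gamma>" and z: "z \<in> cball 0 r" for F z
  proof -
    have ball: "cball z s \<subseteq> \<D>"
    proof
      fix x assume "x \<in> cball z s"
      then show "x \<in> \<D>"
        using z s(2) norm_triangle_sub[of x z] by (simp add: dist_norm norm_minus_commute)
    qed
    have hol: "F holomorphic_on \<D>" using F hol_discD by (auto simp: growth_space_def)
    have weight: "c \<le> (1 - cmod x) powr \<gamma>" if "x \<in> cball z s" for x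
    proof -
      have x: "s \<le> 1 - cmod x" "1 - cmod x \<le> 1"
        using that z norm_triangle_sub[of x z]
        by (auto simp: dist_norm norm_minus_commute s_def field_simps)
      show ?thesis
      proof (cases "\<gamma> \<ge> 0")
        case True
        then have "s powr \<gamma> \<le> (1 - cmod x) powr \<gamma>" using x s by (intro powr_mono2) auto
        then show ?thesis by (simp add: c_def)
      next
        case False
        then have "1 powr \<gamma> \<le> (1 - cmod x) powr \<gamma>" using x s by (intro powr_mono2') auto
        then show ?thesis by (simp add: c_def)
      qed
    qed
    have "cmod ((deriv ^^ 1) F z) \<le> fact 1 * (growth_norm \<gamma> F / c) / s ^ 1"
    proof (rule Cauchy_inequality)
      show "F holomorphic_on ball z s"
        using hol ball ball_subset_cball holomorphic_on_subset by blast
      show "continuous_on (cball z s) F"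
        using hol ball holomorphic_on_imp_continuous_on holomorphic_on_subset by blast
      show "s > 0" by fact
      fix x assume "cmod (z - x) = s"
      then have x: "x \<in> cball z s" by (simp add: dist_norm)
      have "c * cmod (F x) \<le> (1 - cmod x) powr \<gamma> * cmod (F x)"
        using weight[OF x] by (intro mult_right_mono) auto
      also have "\<dots> \<le> growth_norm \<gamma> F"
        using growth_norm_upper[OF F] x ball by blast
      finally show "cmod (F x) \<le> growth_norm \<gamma> F / c"
        using c by (simp add: field_simps)
    qed
    then show ?thesis using c s by (simp add: field_simps)
  qed
  show thesis
    by (rule that[OF _ bound]) (use c s in auto)
qed

section \<open>The Volterra operator\<close>

lemma volterra_integrable:
  assumes g: "g holomorphic_on \<D>" and f: "f \<in> hol_disc" and z: "z \<in> \<D>"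
  shows "(\<lambda>w. f w * deriv g w) contour_integrable_on linepath 0 z"
proof (rule contour_integrable_continuous_linepath)
  have "(\<lambda>w. f w * deriv g w) holomorphic_on \<D>"
    using hol_discD(1)[OF f] holomorphic_deriv[OF g open_ball] by (rule holomorphic_on_mult)
  moreover have "closed_segment 0 z \<subseteq> \<D>"
    using z by (intro closed_segment_subset) auto
  ultimately show "continuous_on (closed_segment 0 z) (\<lambda>w. f w * deriv g w)"
    by (intro holomorphic_on_imp_continuous_on) (rule holomorphic_on_subset)
qed

lemma volterra_add:
  assumes "g holomorphic_on \<D>" "f \<in> hol_disc" "h \<in> hol_disc"
  shows "volterra g (f + h) = volterra g f + volterra g h"
  using assms
  by (simp add: volterra_def fun_eq_iff distrib_right contour_integral_add volterra_integrable)

lemma volterra_scale: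
  assumes "g holomorphic_on \<D>" "f \<in> hol_disc"
  shows "volterra g (fun_scale c f) = fun_scale c (volterra g f)"
  using assms
  by (simp add: volterra_def fun_scale_def fun_eq_iff mult.assoc contour_integral_lmul
      volterra_integrable)

lemma volterra_diff:
  assumes g: "g holomorphic_on \<D>" and f: "f \<in> hol_disc" and h: "h \<in> hol_disc"
  shows "volterra g (f - h) = volterra g f - volterra g h"
  using volterra_add[OF g subspace_fun_scale_diff[OF subspace_hol_disc f h] h]
  by (simp add: eq_diff_eq)

text \<open>On the convex disc the integrand has a primitive \<open>F\<close>, and integration along
  the radius from \<open>0\<close> yields \<open>F w - F 0\<close>. This identity recovers
  \<open>f * deriv g\<close> from the image of \<open>f\<close>.\<close>

lemma volterra_has_field_derivative:
  assumes g: "g holomorphic_on \<D>" and f: "f \<in> hol_disc" and z: "z \<in> \<D>"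
  shows "(volterra g f has_field_derivative f z * deriv g z) (at z)"
proof -
  have "(\<lambda>w. f w * deriv g w) holomorphic_on \<D>"
    using hol_discD(1)[OF f] holomorphic_deriv[OF g open_ball] by (rule holomorphic_on_mult)
  then obtain F where F: "\<And>w. w \<in> \<D> \<Longrightarrow> (F has_field_derivative f w * deriv g w) (at w within \<D>)"
    using holomorphic_convex_primitive'[of \<D>] by auto
  have eq: "F w - F 0 = volterra g f w" if w: "w \<in> \<D>" for w
  proof -
    have "path_image (linepath 0 w) \<subseteq> \<D>"
      using w by (simp add: closed_segment_subset)
    from contour_integral_primitive[OF F valid_path_linepath this]
    show ?thesis
      using w by (simp add: volterra_def contour_integral_unique)
  qed
  have "((\<lambda>w. F w - F 0) has_field_derivative f z * deriv g z) (at z)"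
    using DERIV_diff[OF F[OF z] DERIV_const] at_within_open[OF z open_ball] by simp
  then show ?thesis
    using open_ball z eq by (rule has_field_derivative_transform_within_open)
qed

lemma volterra_hol_disc:
  assumes "g holomorphic_on \<D>" "f \<in> hol_disc"
  shows "volterra g f \<in> hol_disc"
proof -
  have "volterra g f holomorphic_on \<D>"
    using volterra_has_field_derivative[OF assms] unfolding holomorphic_on_open[OF open_ball] by blast
  then show ?thesis by (simp add: hol_disc_def volterra_def)
qed

text \<open>The segment from \<open>0\<close> to \<open>z\<close> lies in
  \<open>cball 0 (cmod z)\<close>, so for fixed \<open>z\<close> the integral is at most its length
  times the bounds for \<open>f\<close> and \<open>deriv g\<close> there. The point is that
  \<open>C\<close> depends on \<open>g\<close> and \<open>z\<close> but not on
  \<open>f\<close>.\<close>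

lemma volterra_bound:
  assumes g: "g holomorphic_on \<D>" and z: "z \<in> \<D>"
  obtains C where
    "\<And>f B. f \<in> hol_disc \<Longrightarrow> (\<And>w. w \<in> cball 0 (cmod z) \<Longrightarrow> cmod (f w) \<le> B) \<Longrightarrow>
      cmod (volterra g f z) \<le> C * B"
proof -
  have sub: "cball 0 (cmod z) \<subseteq> \<D>" using z by auto
  have "continuous_on (cball 0 (cmod z)) (deriv g)"
    using holomorphic_deriv[OF g] sub
    by (intro holomorphic_on_imp_continuous_on) (auto intro: holomorphic_on_subset)
  then have "bounded (deriv g ` cball 0 (cmod z))"
    by (intro compact_imp_bounded compact_continuous_image) auto
  then obtain M where M: "\<And>w. w \<in> cball 0 (cmod z) \<Longrightarrow> cmod (deriv g w) \<le> M"
    unfolding bounded_iff by (metis imageI)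
  have M0: "M \<ge> 0" using order_trans[OF norm_ge_zero M[of 0]] by simp
  have bound: "cmod (volterra g f z) \<le> (M * cmod z) * B"
    if f: "f \<in> hol_disc" and B: "\<And>w. w \<in> cball 0 (cmod z) \<Longrightarrow> cmod (f w) \<le> B" for f B
  proof -
    have B0: "B \<ge> 0" using order_trans[OF norm_ge_zero B[of 0]] by simp
    have "cmod (contour_integral (linepath 0 z) (\<lambda>w. f w * deriv g w)) \<le> (B * M) * cmod (z - 0)"
    proof (rule contour_integral_bound_linepath[OF volterra_integrable[OF g f z]])
      show "0 \<le> B * M" using B0 M0 by simp
      fix w assume "w \<in> closed_segment 0 z"
      then have "w \<in> cball 0 (cmod z)"
        using segment_bound(1)[of w 0 z] by simp
      then show "cmod (f w * deriv g w) \<le> B * M"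
        using B M B0 by (simp add: norm_mult mult_mono)
    qed
    then show ?thesis using z by (simp add: volterra_def mult_ac)
  qed
  show thesis by (rule that[OF bound])
qed

text \<open>By linearity \<open>volterra_bound\<close> applies to \<open>\<sigma> n - f\<close>,
  which is uniformly small on the disc of radius \<open>cmod z\<close>.\<close>

lemma volterra_tendsto:
  assumes g: "g holomorphic_on \<D>" and \<sigma>: "\<And>n. \<sigma> n \<in> hol_disc" and f: "f \<in> hol_disc"
    and lim: "\<And>r. r < 1 \<Longrightarrow> uniform_limit (cball 0 r) \<sigma> f sequentially" and z: "z \<in> \<D>"
  shows "(\<lambda>n. volterra g (\<sigma> n) z) \<longlonglongrightarrow> volterra g f z"
proof (rule tendstoI)
  fix e :: real assume e: "e > 0"
  obtain C where C: "\<And>h B. h \<in> hol_disc \<Longrightarrow> (\<And>w. w \<in> cball 0 (cmod z) \<Longrightarrow> cmod (h w) \<le> B) \<Longrightarrow>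
      cmod (volterra g h z) \<le> C * B"
    using volterra_bound[OF g z] by blast
  define d where "d = e / (\<bar>C\<bar> + 1)"
  have d: "d > 0" using e by (simp add: d_def)
  have "\<forall>\<^sub>F n in sequentially. \<forall>w\<in>cball 0 (cmod z). dist (\<sigma> n w) (f w) < d"
    using lim[of "cmod z"] z d by (auto simp: uniform_limit_iff)
  then show "\<forall>\<^sub>F n in sequentially. dist (volterra g (\<sigma> n) z) (volterra g f z) < e"
  proof eventually_elim
    case (elim n)
    have "cmod (volterra g (\<sigma> n - f) z) \<le> C * d"
      using elim by (intro C subspace_fun_scale_diff[OF subspace_hol_disc \<sigma> f])
        (auto simp: dist_norm less_imp_le)
    also have "\<dots> < (\<bar>C\<bar> + 1) * d"
      using d by (intro mult_strict_right_mono) auto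
    also have "\<dots> = e" by (simp add: d_def)
    finally show ?case
      by (simp add: volterra_diff[OF g \<sigma> f] dist_norm)
  qed
qed

section \<open>Optimal domains\<close>

text \<open>The zeros of \<open>deriv g\<close> in a compact disc are finite in number, so their
  moduli exclude only finitely many of the infinitely many radii between \<open>r\<close> and
  \<open>1\<close>.\<close>

lemma nonconstant_deriv_nonzero_circle:
  assumes g: "g holomorphic_on \<D>" and nonconst: "\<not> g constant_on \<D>" and r: "r < 1"
  obtains \<rho> where "r < \<rho>" "0 < \<rho>" "\<rho> < 1" "\<And>z. cmod z = \<rho> \<Longrightarrow> deriv g z \<noteq> 0"
proof -
  \<comment> \<open>The maximum with \<open>0\<close> makes the chosen radius positive, and
    \<open>b < 1\<close> keeps the zeros under consideration in a compact part of the disc.\<close>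
  define a where "a = max r 0"
  define b where "b = (1 + a) / 2"
  have ab: "r \<le> a" "0 \<le> a" "a < b" "b < 1"
    using r by (auto simp: a_def b_def field_simps)
  have "finite {z \<in> cball 0 b. deriv g z = 0}"
  \<comment> \<open>Finiteness by the identity theorem applies to a nonconstant
    \<open>deriv g\<close>. A constant derivative is nonzero, as \<open>g\<close> would otherwise be
    constant, so it has no zeros at all.\<close>
  proof (cases "deriv g constant_on \<D>")
    case True
    then obtain c where c: "\<And>z. z \<in> \<D> \<Longrightarrow> deriv g z = c"
      by (auto simp: constant_on_def)
    have "c \<noteq> 0"
    proof
      assume "c = 0"
      then have "(g has_field_derivative 0) (at z within \<D>)" if "z \<in> \<D>" for z
        using holomorphic_derivI[OF g open_ball that] c[OF that] by simp
      then have "\<exists>c. \<forall>z\<in>\<D>. g z = c"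
        by (intro has_field_derivative_zero_constant) auto
      then show False using nonconst by (simp add: constant_on_def)
    qed
    then have "{z \<in> cball 0 b. deriv g z = 0} = {}"
      using c ab by auto
    then show ?thesis by (metis finite.emptyI)
  next
    case False
    then show ?thesis
      using ab by (intro holomorphic_compact_finite_zeros[OF holomorphic_deriv[OF g]]) auto
  qed
  then have "infinite ({a<..<b} - cmod ` {z \<in> cball 0 b. deriv g z = 0})"
    using ab by (intro Diff_infinite_finite) auto
  then obtain \<rho> where \<rho>: "\<rho> \<in> {a<..<b} - cmod ` {z \<in> cball 0 b. deriv g z = 0}"
    using infinite_imp_nonempty by blast
  have "deriv g z \<noteq> 0" if "cmod z = \<rho>" for z
    using \<rho> that by (force simp: image_iff)
  then show thesis
    using \<rho> ab by (intro that[of \<rho>]) auto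
qed

text \<open>Division by \<open>deriv g\<close> fails at its zeros, which may lie in
  \<open>cball 0 r\<close>. It is carried out only on a larger circle free of zeros, and the
  analyticity of \<open>f\<close> carries the bound inwards.\<close>

lemma optimal_norm_dominates:
  assumes g: "g holomorphic_on \<D>" and nonconst: "\<not> g constant_on \<D>" and r: "r < 1"
  obtains C where "C \<ge> 0"
    "\<And>f z. f \<in> optimal_domain g (growth_space \<gamma>) \<Longrightarrow> z \<in> cball 0 r \<Longrightarrow>
      cmod (f z) \<le> C * optimal_norm g \<gamma> f"
proof -
  obtain \<rho> where \<rho>: "r < \<rho>" "0 < \<rho>" "\<rho> < 1" and nz: "\<And>z. cmod z = \<rho> \<Longrightarrow> deriv g z \<noteq> 0"
    using nonconstant_deriv_nonzero_circle[OF assms] by blast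
  obtain C where C: "C \<ge> 0"
    "\<And>F z. F \<in> growth_space \<gamma> \<Longrightarrow> z \<in> cball 0 \<rho> \<Longrightarrow> cmod (deriv F z) \<le> C * growth_norm \<gamma> F"
    using growth_space_deriv_bound[OF \<rho>(3)] by blast
  have "continuous_on (sphere 0 \<rho>) (\<lambda>z. cmod (deriv g z))"
    using holomorphic_deriv[OF g] \<rho>
    by (intro continuous_on_norm holomorphic_on_imp_continuous_on)
       (auto intro: holomorphic_on_subset)
  then obtain w where w: "w \<in> sphere 0 \<rho>"
    "\<And>z. z \<in> sphere 0 \<rho> \<Longrightarrow> cmod (deriv g w) \<le> cmod (deriv g z)"
    using continuous_attains_inf[of "sphere 0 \<rho>" "\<lambda>z. cmod (deriv g z)"] \<rho> by auto
  \<comment> \<open>The minimum of \<open>cmod (deriv g z)\<close> over the circle is attained,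
    hence positive; dividing the Cauchy constant by it gives \<open>C / m\<close>.\<close>
  define m where "m = cmod (deriv g w)"
  have m: "m > 0" using nz w(1) by (simp add: m_def)
  have bound: "cmod (f z) \<le> (C / m) * optimal_norm g \<gamma> f"
    if f: "f \<in> optimal_domain g (growth_space \<gamma>)" and z: "z \<in> cball 0 r" for f z
  proof -
    have fh: "f \<in> hol_disc" and V: "volterra g f \<in> growth_space \<gamma>"
      using f by (auto simp: optimal_domain_def)
    have sub: "cball 0 \<rho> \<subseteq> \<D>" using \<rho> by auto
    show ?thesis
    proof (rule maximum_modulus_frontier[where S = "cball 0 \<rho>" and f = f and \<xi> = z])
      show "f holomorphic_on interior (cball 0 \<rho>)"
        using hol_discD(1)[OF fh] sub holomorphic_on_subset interior_subset by blast
      show "continuous_on (closure (cball 0 \<rho>)) f"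
        using hol_discD(1)[OF fh] sub
        by (auto intro: holomorphic_on_subset holomorphic_on_imp_continuous_on)
      show "bounded (cball (0::complex) \<rho>)" by simp
      show "z \<in> cball 0 \<rho>" using z \<rho> by simp
      fix u :: complex assume "u \<in> frontier (cball 0 \<rho>)"
      then have u: "u \<in> sphere 0 \<rho>" "u \<in> cball 0 \<rho>" by auto
      have "m * cmod (f u) \<le> cmod (deriv g u) * cmod (f u)"
        using w(2)[OF u(1)] by (intro mult_right_mono) (auto simp: m_def)
      also have "\<dots> = cmod (deriv (volterra g f) u)"
        using DERIV_imp_deriv[OF volterra_has_field_derivative[OF g fh, of u]] u(2) sub
        by (auto simp: norm_mult)
      also have "\<dots> \<le> C * optimal_norm g \<gamma> f"
        using C(2)[OF V u(2)] by (simp add: optimal_norm_def)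
      finally show "cmod (f u) \<le> C / m * optimal_norm g \<gamma> f"
        using m by (simp add: field_simps)
    qed
  qed
  show thesis
    by (rule that[OF _ bound]) (use C(1) m in auto)
qed

section \<open>Norm and completeness of optimal domains\<close>

lemma subspace_optimal_domain:
  assumes g: "g holomorphic_on \<D>" and Y: "module.subspace fun_scale Y"
  shows "module.subspace fun_scale (optimal_domain g Y)"
proof -
  have "volterra g 0 = 0"
    by (simp add: volterra_def fun_eq_iff)
  then show ?thesis
    using Y subspace_hol_disc
    by (auto simp: subspace_fun_scale_iff optimal_domain_def volterra_add[OF g] volterra_scale[OF g])
qed

text \<open>The optimal norm is pulled back along a linear map, so only definiteness has content: it
  follows from \<open>optimal_norm_dominates\<close> on the disc of radius
  \<open>cmod z\<close>.\<close>

lemma is_norm_on_optimal_domain: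
  assumes g: "g holomorphic_on \<D>" and nonconst: "\<not> g constant_on \<D>"
    and Y: "Y \<subseteq> growth_space \<gamma>"
  shows "is_norm_on (optimal_domain g Y) (optimal_norm g \<gamma>)"
proof -
  have D: "f \<in> hol_disc" "volterra g f \<in> growth_space \<gamma>" if "f \<in> optimal_domain g Y" for f
    using that Y by (auto simp: optimal_domain_def)
  have zero: "f = 0" if f: "f \<in> optimal_domain g Y" and N: "optimal_norm g \<gamma> f = 0" for f
  proof
    fix z
    show "f z = 0 z"
    proof (cases "z \<in> \<D>")
      case True
      then have r: "cmod z < 1" by simp
      obtain C where "\<And>f w. f \<in> optimal_domain g (growth_space \<gamma>) \<Longrightarrow> w \<in> cball 0 (cmod z) \<Longrightarrow>
          cmod (f w) \<le> C * optimal_norm g \<gamma> f"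
        using optimal_norm_dominates[OF g nonconst r] by blast
      from this[of f z] show ?thesis
        using D[OF f] N by (simp add: optimal_domain_def)
    next
      case False
      then show ?thesis using hol_discD(2)[OF D(1)[OF f]] by simp
    qed
  qed
  have "volterra g 0 = 0"
    by (simp add: volterra_def fun_eq_iff)
  then have "optimal_norm g \<gamma> 0 = 0"
    by (simp add: optimal_norm_def growth_norm_def)
  then show ?thesis
    using zero growth_norm_nonneg[OF D(2)] growth_norm_add[OF D(2) D(2)] growth_norm_scale[OF D(2)]
    by (auto simp: is_norm_on_def optimal_norm_def volterra_add[OF g D(1) D(1)]
        volterra_scale[OF g D(1)])
qed

text \<open>The abstract closedness of \<open>Y\<close> allows one argument to serve both growth
  spaces. The limit function is found by uniform convergence on discs; convergence in norm is then
  proved for its image.\<close>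

lemma mcomplete_optimal_domain:
  assumes g: "g holomorphic_on \<D>" and nonconst: "\<not> g constant_on \<D>"
    and Y: "Y \<subseteq> growth_space \<gamma>" and sub: "module.subspace fun_scale Y"
    and closed: "\<And>F. F \<in> hol_disc \<Longrightarrow>
      (\<And>e. e > 0 \<Longrightarrow> \<exists>h\<in>Y. \<forall>z\<in>\<D>. (1 - cmod z) powr \<gamma> * cmod (F z - h z) \<le> e) \<Longrightarrow> F \<in> Y"
  shows "Metric_space.mcomplete (optimal_domain g Y)
    (norm_dist (optimal_domain g Y) (optimal_norm g \<gamma>))"
proof -
  let ?X = "optimal_domain g Y" and ?N = "optimal_norm g \<gamma>"
  have subX: "module.subspace fun_scale ?X"
    using g sub by (rule subspace_optimal_domain)
  interpret Metric_space ?X "norm_dist ?X ?N"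
    using subX is_norm_on_optimal_domain[OF g nonconst Y] by (rule Metric_space_norm_dist)
  have D: "f \<in> hol_disc" "volterra g f \<in> Y" "f \<in> optimal_domain g (growth_space \<gamma>)"
    if "f \<in> ?X" for f
    using that Y by (auto simp: optimal_domain_def)
  show ?thesis
    unfolding mcomplete_def
  proof (intro allI impI)
    fix \<sigma> assume \<sigma>: "MCauchy \<sigma>"
    have X: "\<sigma> n \<in> ?X" for n
      using \<sigma> by (auto simp: MCauchy_def)
    have dX: "\<sigma> m - \<sigma> n \<in> ?X" for m n
      using subspace_fun_scale_diff[OF subX X X] .
    have Cauchy: "\<exists>M. \<forall>m\<ge>M. \<forall>n\<ge>M. ?N (\<sigma> m - \<sigma> n) < e" if "e > 0" for e
    proof -
      have "\<exists>M. \<forall>m n. M \<le> m \<longrightarrow> M \<le> n \<longrightarrow> norm_dist ?X ?N (\<sigma> m) (\<sigma> n) < e"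
        using \<sigma> that by (simp add: MCauchy_def)
      then show ?thesis by (auto simp: norm_dist_def X)
    qed
    have "uniformly_Cauchy_on (cball 0 r) \<sigma>" if r: "r < 1" for r
    proof (rule uniformly_Cauchy_onI)
      fix e :: real assume e: "e > 0"
      obtain C where C: "C \<ge> 0" "\<And>f z. f \<in> optimal_domain g (growth_space \<gamma>) \<Longrightarrow>
          z \<in> cball 0 r \<Longrightarrow> cmod (f z) \<le> C * ?N f"
        using optimal_norm_dominates[OF g nonconst r] by blast
      \<comment> \<open>Dividing by \<open>C + 1\<close> makes \<open>C * (e / (C + 1))\<close>
        strictly smaller than \<open>e\<close>, also when \<open>C = 0\<close>.\<close>
      obtain M where M: "\<And>m n. m \<ge> M \<Longrightarrow> n \<ge> M \<Longrightarrow> ?N (\<sigma> m - \<sigma> n) < e / (C + 1)"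
        using Cauchy[of "e / (C + 1)"] e C(1) by fastforce
      have "dist (\<sigma> m z) (\<sigma> n z) < e" if "z \<in> cball 0 r" "m \<ge> M" "n \<ge> M" for z m n
      proof -
        have "dist (\<sigma> m z) (\<sigma> n z) \<le> C * ?N (\<sigma> m - \<sigma> n)"
          using C(2)[OF D(3)[OF dX] that(1)] by (simp add: dist_norm)
        also have "\<dots> \<le> C * (e / (C + 1))"
          using M[OF that(2,3)] C(1) by (intro mult_left_mono) auto
        also have "\<dots> < e" using C(1) e by (simp add: field_simps)
        finally show ?thesis .
      qed
      then show "\<exists>M. \<forall>z\<in>cball 0 r. \<forall>m\<ge>M. \<forall>n\<ge>M. dist (\<sigma> m z) (\<sigma> n z) < e"
        by blast
    qed
    then obtain f where f: "f \<in> hol_disc"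
      and lim: "\<And>r. r < 1 \<Longrightarrow> uniform_limit (cball 0 r) \<sigma> f sequentially"
      using hol_disc_uniform_Cauchy_limit[of \<sigma>] D(1)[OF X] by blast
    have approx: "\<exists>M. \<forall>n\<ge>M. \<forall>z\<in>\<D>.
        (1 - cmod z) powr \<gamma> * cmod (volterra g f z - volterra g (\<sigma> n) z) \<le> e" if e: "e > 0" for e
    proof -
      obtain M where M: "\<And>m n. m \<ge> M \<Longrightarrow> n \<ge> M \<Longrightarrow> ?N (\<sigma> m - \<sigma> n) < e"
        using Cauchy[OF e] by blast
      have "(1 - cmod z) powr \<gamma> * cmod (volterra g f z - volterra g (\<sigma> n) z) \<le> e"
        if n: "n \<ge> M" and z: "z \<in> \<D>" for n z
      \<comment> \<open>With \<open>n\<close> and \<open>z\<close> fixed, \<open>m\<close> tends to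
        infinity. As \<open>M\<close> was chosen from the norm alone, the resulting bound is uniform
        in \<open>z\<close>.\<close>
      proof (rule tendsto_upperbound)
        show "(\<lambda>m. (1 - cmod z) powr \<gamma> * cmod (volterra g (\<sigma> m) z - volterra g (\<sigma> n) z))
            \<longlonglongrightarrow> (1 - cmod z) powr \<gamma> * cmod (volterra g f z - volterra g (\<sigma> n) z)"
          by (intro tendsto_intros volterra_tendsto[OF g _ f lim z] D(1) X)
        have "(1 - cmod z) powr \<gamma> * cmod (volterra g (\<sigma> m) z - volterra g (\<sigma> n) z) \<le> e"
          if m: "m \<ge> M" for m
        proof -
          have "(1 - cmod z) powr \<gamma> * cmod (volterra g (\<sigma> m - \<sigma> n) z) \<le> ?N (\<sigma> m - \<sigma> n)"
            unfolding optimal_norm_def using D(2)[OF dX] Y z by (intro growth_norm_upper) auto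
          then show ?thesis
            using M[OF m n] by (simp add: volterra_diff[OF g D(1)[OF X] D(1)[OF X]])
        qed
        then show "\<forall>\<^sub>F m in sequentially.
            (1 - cmod z) powr \<gamma> * cmod (volterra g (\<sigma> m) z - volterra g (\<sigma> n) z) \<le> e"
          by (auto simp: eventually_sequentially)
      qed simp
      then show ?thesis by blast
    qed
    have "volterra g f \<in> Y"
    \<comment> \<open>The images of the members of the sequence are themselves the approximants from
      \<open>Y\<close>.\<close>
    proof (rule closed[OF volterra_hol_disc[OF g f]])
      fix e :: real assume "e > 0"
      then show "\<exists>h\<in>Y. \<forall>z\<in>\<D>. (1 - cmod z) powr \<gamma> * cmod (volterra g f z - h z) \<le> e"
        using approx[of e] D(2)[OF X] by blast
    qed
    then have fX: "f \<in> ?X" using f by (simp add: optimal_domain_def)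
    have "limitin mtopology \<sigma> f sequentially"
      unfolding limitin_metric
    proof (intro conjI allI impI fX)
      fix e :: real assume e: "e > 0"
      \<comment> \<open>Passing to the supremum preserves only a weak inequality;
        \<open>e / 2\<close> leaves room for the strict one.\<close>
      obtain M where M: "\<And>n z. n \<ge> M \<Longrightarrow> z \<in> \<D> \<Longrightarrow>
          (1 - cmod z) powr \<gamma> * cmod (volterra g f z - volterra g (\<sigma> n) z) \<le> e / 2"
        using approx[of "e / 2"] e by (metis half_gt_zero)
      have "norm_dist ?X ?N (\<sigma> n) f < e" if n: "n \<ge> M" for n
      proof -
        have "?N (\<sigma> n - f) \<le> e / 2"
          unfolding optimal_norm_def volterra_diff[OF g D(1)[OF X] f]
          using M[OF n] by (intro growth_norm_least) (simp add: norm_minus_commute)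
        then show ?thesis using e X fX by (simp add: norm_dist_def)
      qed
      then show "\<forall>\<^sub>F n in sequentially. \<sigma> n \<in> ?X \<and> norm_dist ?X ?N (\<sigma> n) f < e"
        using X by (auto simp: eventually_sequentially)
    qed
    then show "\<exists>f. limitin mtopology \<sigma> f sequentially" by blast
  qed
qed

lemma banach_space_optimal_domain:
  assumes g: "g holomorphic_on \<D>" and nonconst: "\<not> g constant_on \<D>"
    and Y: "Y \<subseteq> growth_space \<gamma>" and sub: "module.subspace fun_scale Y"
    and closed: "\<And>F. F \<in> hol_disc \<Longrightarrow>
      (\<And>e. e > 0 \<Longrightarrow> \<exists>h\<in>Y. \<forall>z\<in>\<D>. (1 - cmod z) powr \<gamma> * cmod (F z - h z) \<le> e) \<Longrightarrow> F \<in> Y"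
  shows "banach_space_of_analytic_functions (optimal_domain g Y) (optimal_norm g \<gamma>)"
  unfolding banach_space_of_analytic_functions_def
proof (intro conjI)
  show X: "optimal_domain g Y \<subseteq> hol_disc" by (auto simp: optimal_domain_def)
  show subX: "module.subspace fun_scale (optimal_domain g Y)"
    using g sub by (rule subspace_optimal_domain)
  show N: "is_norm_on (optimal_domain g Y) (optimal_norm g \<gamma>)"
    using g nonconst Y by (rule is_norm_on_optimal_domain)
  show "Metric_space.mcomplete (optimal_domain g Y)
      (norm_dist (optimal_domain g Y) (optimal_norm g \<gamma>))"
    using g nonconst Y sub closed by (rule mcomplete_optimal_domain)
  have "optimal_domain g Y \<subseteq> optimal_domain g (growth_space \<gamma>)"
    using Y by (auto simp: optimal_domain_def)
  then have "\<exists>C. \<forall>f\<in>optimal_domain g Y. \<forall>z\<in>cball 0 r. cmod (f z) \<le> C * optimal_norm g \<gamma> f"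
    if "r < 1" for r
    using optimal_norm_dominates[OF g nonconst that] by (meson subsetD)
  then show "continuous_map
      (Metric_space.mtopology (optimal_domain g Y) (norm_dist (optimal_domain g Y) (optimal_norm g \<gamma>)))
      hol_disc_topology (\<lambda>f. f)"
    by (rule continuous_map_into_hol_disc_topology[OF X subX N])
qed

theorem corollary3p4:
  fixes g :: "complex \<Rightarrow> complex" and \<gamma> :: real
  assumes "g \<in> bloch_space"
    and "\<not> g constant_on \<D>"
    and "\<gamma> > 0"
  shows "banach_space_of_analytic_functions
           (optimal_domain g (growth_space \<gamma>)) (optimal_norm g \<gamma>) \<and>
         banach_space_of_analytic_functions
           (optimal_domain g (growth_space0 \<gamma>)) (optimal_norm g \<gamma>) \<and>
         point_eval (optimal_domain g (growth_space \<gamma>)) ` \<D>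
           \<subseteq> dual_space (optimal_domain g (growth_space \<gamma>)) (optimal_norm g \<gamma>) \<and>
         point_eval (optimal_domain g (growth_space0 \<gamma>)) ` \<D>
           \<subseteq> dual_space (optimal_domain g (growth_space0 \<gamma>)) (optimal_norm g \<gamma>)"
proof -
  have g: "g holomorphic_on \<D>"
    using assms(1) by (simp add: bloch_space_def hol_disc_def)
  have "banach_space_of_analytic_functions (optimal_domain g (growth_space \<gamma>)) (optimal_norm g \<gamma>)"
    by (rule banach_space_optimal_domain[OF g assms(2) order_refl subspace_growth_space
          growth_space_closed])
  moreover have
    "banach_space_of_analytic_functions (optimal_domain g (growth_space0 \<gamma>)) (optimal_norm g \<gamma>)"
    by (rule banach_space_optimal_domain[OF g assms(2) growth_space0_subset subspace_growth_space0
          growth_space0_closed])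
  ultimately show ?thesis
    using point_eval_in_dual_space by blast
qed

end
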